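(* Let $X$ be a triangle center with center function $f$ that is concurrent for some admissible transversal $\ell$ of a triangle $ABC$. Let $X'$ be the center whose center function is obtained from $f$ by applying a preserving operation. Then $X'$ is concurrent for $\ell$.
   Context: An admissible transversal of $\triangle ABC$ is a line $\ell$ that passes through no vertex and is parallel to no side; it meets the sidelines $BC,CA,AB$ at $D,E,F$ respectively. A (barycentric) center function is a function $f(x,y,z)$ of side lengths, homogeneous and symmetric in its last two arguments; for a triangle $P_1P_2P_3$ whose sides opposite $P_1,P_2,P_3$ have lengths $\lambda_1,\lambda_2,\lambda_3$, its $X$-point is the point with homogeneous barycentric coordinates $(f(\lambda_1,\lambda_2,\lambda_3):f(\lambda_2,\lambda_3,\lambda_1):f(\lambda_3,\lambda_1,\lambda_2))$ relative to $P_1P_2P_3$. With $G,H,I$ the $X$-points of triangles $AEF$, $BFD$, $CDE$, the center $X$ is called concurrent for $\ell$ if the lines $AG,BH,CI$ are concurrent (three parallel lines count as concurrent). For a center function $f=f(a,b,c)$ write $S_A=b^2+c^2-a^2$, $S_B=c^2+a^2-b^2$, $S_C=a^2+b^2-c^2$ and $\cos^2A=S_A^2/(4b^2c^2)$. The preserving operations are: (O1) isotomic: $f\mapsto 1/f$, defined wherever $f\ne0$; (O2) isogonal: $f\mapsto a^2/f$, defined wherever $f\neq 0$; (O3) side-power $f\mapsto a^kf$ and co-side-power $f\mapsto (bc)^jf$, with $k,j\in\mathbb Z$; (O4) Conway-even: $f\mapsto S_A^{2m}f$ and $f\mapsto (S_BS_C)^{2n}f$, with $m,n$ integers; (O5)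 symmetric: $f\mapsto\sigma(a,b,c)f$ with $\sigma$ symmetric; (O6) angular multiplier: $f\mapsto\Phi(\cos^2A)f$ for any one-variable function $\Phi$. It is tacitly understood that the center functions involved are defined at the side lengths of the corner triangles and that, for both $X$ and $X'$, the three points constructed differ from $A,B,C$ respectively, so that the three lines make sense. *)

theory Defs
  imports "HOL-Analysis.Analysis"
begin

text \<open>Functions of three side lengths are partial: \<^term>\<open>None\<close> means undefined. Only the values
  at side lengths of nondegenerate triangles matter.\<close>

type_synonym side_fun = "real \<Rightarrow> real \<Rightarrow> real \<Rightarrow> real option"

definition triangle_sides :: "real \<Rightarrow> real \<Rightarrow> real \<Rightarrow> bool" where
  "triangle_sides a b c \<longleftrightarrow> a < b + c \<and> b < c + a \<and> c < a + b"

definition homogeneous_fun :: "side_fun \<Rightarrow> bool" where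
  "homogeneous_fun f \<longleftrightarrow> (\<exists>d::real. \<forall>a b c t. triangle_sides a b c \<and> t > 0 \<longrightarrow>
     f (t * a) (t * b) (t * c) = map_option (\<lambda>v. t powr d * v) (f a b c))"

definition center_function :: "side_fun \<Rightarrow> bool" where
  "center_function f \<longleftrightarrow> homogeneous_fun f \<and>
     (\<forall>a b c. triangle_sides a b c \<longrightarrow> f a b c = f a c b)"

definition symmetric_fun :: "side_fun \<Rightarrow> bool" where
  "symmetric_fun s \<longleftrightarrow> (\<forall>a b c. triangle_sides a b c \<longrightarrow>
     s a b c = s b a c \<and> s a b c = s a c b)"

text \<open>Nonzero barycentric coordinates with zero sum describe a point at infinity, represented by a
  direction vector. That vector is determined only up to a nonzero factor, so values
  \<^term>\<open>At_Infinity v\<close> are used only through the lines they determine and are not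
  compared with each other.\<close>

datatype ext_point = Proper "real^2" | At_Infinity "real^2"

definition barycentric_point ::
  "real \<Rightarrow> real \<Rightarrow> real \<Rightarrow> real^2 \<Rightarrow> real^2 \<Rightarrow> real^2 \<Rightarrow> ext_point option" where
  "barycentric_point u v w P1 P2 P3 =
     (if u = 0 \<and> v = 0 \<and> w = 0 then None
      else if u + v + w = 0 then Some (At_Infinity (u *\<^sub>R P1 + v *\<^sub>R P2 + w *\<^sub>R P3))
      else Some (Proper ((1 / (u + v + w)) *\<^sub>R (u *\<^sub>R P1 + v *\<^sub>R P2 + w *\<^sub>R P3))))"

definition center_point :: "side_fun \<Rightarrow> real^2 \<Rightarrow> real^2 \<Rightarrow> real^2 \<Rightarrow> ext_point option" where
  "center_point f P1 P2 P3 =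
     (let l1 = dist P2 P3; l2 = dist P3 P1; l3 = dist P1 P2 in
      case (f l1 l2 l3, f l2 l3 l1, f l3 l1 l2) of
        (Some u, Some v, Some w) \<Rightarrow> barycentric_point u v w P1 P2 P3
      | _ \<Rightarrow> None)"

fun join_line :: "real^2 \<Rightarrow> ext_point \<Rightarrow> (real^2) set" where
  "join_line P (Proper Q) = affine hull {P, Q}"
| "join_line P (At_Infinity v) = range (\<lambda>t::real. P + t *\<^sub>R v)"

definition concurrent_lines :: "(real^2) set \<Rightarrow> (real^2) set \<Rightarrow> (real^2) set \<Rightarrow> bool" where
  "concurrent_lines L M N \<longleftrightarrow>
     L \<inter> M \<inter> N \<noteq> {} \<or> (affine_parallel L M \<and> affine_parallel M N \<and> affine_parallel L N)"

definition admissible_transversal ::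
  "real^2 \<Rightarrow> real^2 \<Rightarrow> real^2 \<Rightarrow> (real^2) set \<Rightarrow> bool" where
  "admissible_transversal A B C l \<longleftrightarrow>
     affine l \<and> aff_dim l = 1 \<and> A \<notin> l \<and> B \<notin> l \<and> C \<notin> l \<and>
     \<not> affine_parallel l (affine hull {B, C}) \<and>
     \<not> affine_parallel l (affine hull {C, A}) \<and>
     \<not> affine_parallel l (affine hull {A, B})"

text \<open>\<^term>\<open>corner_lines f A B C l L M N\<close>: the lines \<open>AG\<close>, \<open>BH\<close>, \<open>CI\<close> make sense and are
  \<open>L\<close>, \<open>M\<close>, \<open>N\<close>.\<close>

definition corner_lines ::
  "side_fun \<Rightarrow> real^2 \<Rightarrow> real^2 \<Rightarrow> real^2 \<Rightarrow> (real^2) set \<Rightarrow>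
   (real^2) set \<Rightarrow> (real^2) set \<Rightarrow> (real^2) set \<Rightarrow> bool" where
  "corner_lines f A B C l L M N \<longleftrightarrow>
     (\<exists>D E F G H I.
        l \<inter> affine hull {B, C} = {D} \<and>
        l \<inter> affine hull {C, A} = {E} \<and>
        l \<inter> affine hull {A, B} = {F} \<and>
        center_point f A E F = Some G \<and> G \<noteq> Proper A \<and>
        center_point f B F D = Some H \<and> H \<noteq> Proper B \<and>
        center_point f C D E = Some I \<and> I \<noteq> Proper C \<and>
        L = join_line A G \<and> M = join_line B H \<and> N = join_line C I)"

definition concurrent_for ::
  "side_fun \<Rightarrow> real^2 \<Rightarrow> real^2 \<Rightarrow> real^2 \<Rightarrow> (real^2) set \<Rightarrow> bool" where
  "concurrent_for f A B C l \<longleftrightarrow>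
     (\<exists>L M N. corner_lines f A B C l L M N \<and> concurrent_lines L M N)"

definition mult_fun :: "side_fun \<Rightarrow> side_fun \<Rightarrow> side_fun" where
  "mult_fun g f a b c =
     (case (g a b c, f a b c) of (Some u, Some v) \<Rightarrow> Some (u * v) | _ \<Rightarrow> None)"

definition partial_recip :: "real \<Rightarrow> real option" where
  "partial_recip x = (if x = 0 then None else Some (1 / x))"

definition partial_power :: "real \<Rightarrow> int \<Rightarrow> real option" where
  "partial_power x k = (if x = 0 \<and> k < 0 then None else Some (x powi k))"

text \<open>\<open>S_A\<close> is \<open>conway a b c\<close>, \<open>S_B\<close> is \<open>conway b c a\<close>, \<open>S_C\<close> is \<open>conway c a b\<close>.\<close>

definition conway :: "real \<Rightarrow> real \<Rightarrow> real \<Rightarrow> real" where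
  "conway a b c = b\<^sup>2 + c\<^sup>2 - a\<^sup>2"

definition cos_sq_angle :: "real \<Rightarrow> real \<Rightarrow> real \<Rightarrow> real" where
  "cos_sq_angle a b c = (conway a b c)\<^sup>2 / (4 * b\<^sup>2 * c\<^sup>2)"

inductive preserving_operation :: "side_fun \<Rightarrow> side_fun \<Rightarrow> bool" for f :: side_fun where
  isotomic:
    "preserving_operation f (\<lambda>a b c. Option.bind (f a b c) partial_recip)"
| isogonal:
    "preserving_operation f
       (mult_fun (\<lambda>a b c. Some (a\<^sup>2)) (\<lambda>a b c. Option.bind (f a b c) partial_recip))"
| side_power:
    "preserving_operation f (mult_fun (\<lambda>a b c. partial_power a k) f)"
| co_side_power:
    "preserving_operation f (mult_fun (\<lambda>a b c. partial_power (b * c) j) f)"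
| conway_even:
    "preserving_operation f (mult_fun (\<lambda>a b c. partial_power (conway a b c) (2 * m)) f)"
| co_conway_even:
    "preserving_operation f
       (mult_fun (\<lambda>a b c. partial_power (conway b c a * conway c a b) (2 * n)) f)"
| symmetric:
    "symmetric_fun \<sigma> \<Longrightarrow> preserving_operation f (mult_fun \<sigma> f)"
| angular:
    "preserving_operation f (mult_fun (\<lambda>a b c. \<Phi> (cos_sq_angle a b c)) f)"
  for \<Phi> :: "real \<Rightarrow> real option"

end

theory Submission
  imports Defs
begin

text \<open>The line \<open>AG\<close> depends only on the ratio of the second and third barycentric coordinates of
  \<open>G\<close> relative to \<open>AEF\<close>, that is, of \<open>f(FA, AE, EF)\<close> and \<open>f(AE, EF, FA)\<close>; likewise for \<open>BH\<close>
  and \<open>CI\<close>. Rewriting these coordinates relative to \<open>ABC\<close> introduces the signed ratios in which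
  \<open>D\<close>, \<open>E\<close>, \<open>F\<close> divide the sides. Ceva's theorem (\<open>ceva\<close>, including lines along a side and
  parallel lines) turns concurrency into an equation between two products, from which Menelaus'
  theorem (\<open>menelaus\<close>) cancels the ratios up to a sign. So the three lines are concurrent if and
  only if \<open>V + W = 0\<close>, where
  \<open>V = f(FA, AE, EF) f(DB, BF, FD) f(EC, CD, DE)\<close> and
  \<open>W = f(AE, EF, FA) f(BF, FD, DB) f(CD, DE, EC)\<close>
  (\<open>concurrent_iff_balanced\<close>).

  The relation \<open>V = - W\<close> survives taking reciprocals of all values, and it survives multiplying
  \<open>f\<close> by a function \<open>g\<close> whose own two products agree. The latter holds for powers of the sides
  by Menelaus' theorem for lengths, \<open>FA \<cdot> DB \<cdot> EC = AE \<cdot> BF \<cdot> CD\<close>; for symmetric functions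
  trivially; and for functions of the squared cosine of the angle because the arguments in both
  products are the angles at \<open>E\<close>, \<open>F\<close>, \<open>D\<close>, each taken in one of the two corner triangles
  meeting there: those two angles are equal or supplementary. Since
  \<open>S\<^sub>A\<^sup>2 = 4 b\<^sup>2 c\<^sup>2 cos\<^sup>2 A\<close>, the Conway factors reduce to these cases
  (\<open>balanced_preserving_operation\<close>).\<close>

section \<open>The effect of a preserving operation on center function values\<close>

lemma mult_fun_eq_SomeD:
  assumes "mult_fun g f a b c = Some v" "f a b c = Some u"
  shows "\<exists>m. g a b c = Some m \<and> v = m * u"
  using assms by (auto simp: mult_fun_def split: option.splits)

lemma bind_partial_recip_eq_SomeD:
  assumes "Option.bind (f a b c) partial_recip = Some v" "f a b c = Some u"
  shows "u \<noteq> 0 \<and> v = 1 / u"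
  using assms by (auto simp: partial_recip_def split: if_splits)

lemma partial_power_eq_SomeD: "partial_power x k = Some v \<Longrightarrow> v = x powi k"
  by (auto simp: partial_power_def split: if_splits)

lemma partial_power_even_prod_eq:
  assumes "partial_power x1 (2 * k) = Some u1" "partial_power x2 (2 * k) = Some u2"
    "partial_power x3 (2 * k) = Some u3"
    "partial_power y1 (2 * k) = Some v1" "partial_power y2 (2 * k) = Some v2"
    "partial_power y3 (2 * k) = Some v3"
    and sq: "x1\<^sup>2 * x2\<^sup>2 * x3\<^sup>2 = y1\<^sup>2 * y2\<^sup>2 * y3\<^sup>2"
  shows "u1 * u2 * u3 = v1 * v2 * v3"
proof -
  have eq: "u1 = x1\<^sup>2 powi k" "u2 = x2\<^sup>2 powi k" "u3 = x3\<^sup>2 powi k"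
    "v1 = y1\<^sup>2 powi k" "v2 = y2\<^sup>2 powi k" "v3 = y3\<^sup>2 powi k"
    using assms(1-6) by (auto dest!: partial_power_eq_SomeD simp: power_int_mult)
  show ?thesis
    unfolding eq power_int_mult_distrib[symmetric] sq ..
qed

lemma triangle_sides_pos:
  assumes "triangle_sides x y z"
  shows "0 < x" "0 < y" "0 < z"
  using assms by (auto simp: triangle_sides_def)

lemma conway_sq_eq:
  assumes "0 < b" "0 < c"
  shows "(conway a b c)\<^sup>2 = cos_sq_angle a b c * (4 * b\<^sup>2 * c\<^sup>2)"
  using assms by (simp add: cos_sq_angle_def)

lemma cos_sq_angle_commute: "cos_sq_angle a b c = cos_sq_angle a c b"
  by (simp add: cos_sq_angle_def conway_def algebra_simps)

text \<open>The side lengths \<open>x\<^sub>i, y\<^sub>i, z\<^sub>i\<close> of the corner triangles \<open>AEF\<close>, \<open>BFD\<close>, \<open>CDE\<close> (for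
  \<open>i = 1, 2, 3\<close>), each opposite the first, second and third vertex in this order; so the \<open>x\<^sub>i\<close>
  lie on the transversal. The lengths satisfy the
  (unsigned) Menelaus relation \<open>y\<^sub>1 y\<^sub>2 y\<^sub>3 = z\<^sub>1 z\<^sub>2 z\<^sub>3\<close>, and at each of the points where the
  transversal meets a sideline, the angles of the two corner triangles are equal or supplementary,
  so their cosines have equal squares.\<close>

locale corner_sides =
  fixes x1 y1 z1 x2 y2 z2 x3 y3 z3 :: real
  assumes tri: "triangle_sides x1 y1 z1" "triangle_sides x2 y2 z2" "triangle_sides x3 y3 z3"
    and menelaus_lengths: "y1 * y2 * y3 = z1 * z2 * z3"
    and cos_sq_at_E: "cos_sq_angle y1 z1 x1 = cos_sq_angle z3 x3 y3"
    and cos_sq_at_F: "cos_sq_angle y2 z2 x2 = cos_sq_angle z1 x1 y1"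
    and cos_sq_at_D: "cos_sq_angle y3 z3 x3 = cos_sq_angle z2 x2 y2"
begin

lemmas pos = tri[THEN triangle_sides_pos(1)] tri[THEN triangle_sides_pos(2)]
  tri[THEN triangle_sides_pos(3)]

text \<open>The relation \<open>V + W = 0\<close>: the \<open>v\<^sub>i\<close> are the coordinates of the three centers at the second
  vertices of \<open>AEF\<close>, \<open>BFD\<close>, \<open>CDE\<close>, and the \<open>w\<^sub>i\<close> those at the third vertices.\<close>

definition balanced :: "side_fun \<Rightarrow> bool" where
  "balanced f \<longleftrightarrow> (\<exists>v1 v2 v3 w1 w2 w3.
     f y1 z1 x1 = Some v1 \<and> f y2 z2 x2 = Some v2 \<and> f y3 z3 x3 = Some v3 \<and>
     f z1 x1 y1 = Some w1 \<and> f z2 x2 y2 = Some w2 \<and> f z3 x3 y3 = Some w3 \<and>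
     v1 * v2 * v3 + w1 * w2 * w3 = 0)"

text \<open>All six values entering this relation exist.\<close>

definition defined :: "side_fun \<Rightarrow> bool" where
  "defined f \<longleftrightarrow> f y1 z1 x1 \<noteq> None \<and> f y2 z2 x2 \<noteq> None \<and> f y3 z3 x3 \<noteq> None \<and>
     f z1 x1 y1 \<noteq> None \<and> f z2 x2 y2 \<noteq> None \<and> f z3 x3 y3 \<noteq> None"

lemma balanced_mult_fun:
  assumes "balanced f" "defined (mult_fun g f)"
    and mult: "\<And>u1 u2 u3 t1 t2 t3.
      g y1 z1 x1 = Some u1 \<Longrightarrow> g y2 z2 x2 = Some u2 \<Longrightarrow> g y3 z3 x3 = Some u3 \<Longrightarrow>
      g z1 x1 y1 = Some t1 \<Longrightarrow> g z2 x2 y2 = Some t2 \<Longrightarrow> g z3 x3 y3 = Some t3 \<Longrightarrow>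
      u1 * u2 * u3 = t1 * t2 * t3"
  shows "balanced (mult_fun g f)"
proof -
  obtain v1 v2 v3 w1 w2 w3 where f:
    "f y1 z1 x1 = Some v1" "f y2 z2 x2 = Some v2" "f y3 z3 x3 = Some v3"
    "f z1 x1 y1 = Some w1" "f z2 x2 y2 = Some w2" "f z3 x3 y3 = Some w3"
    and sum: "v1 * v2 * v3 + w1 * w2 * w3 = 0"
    using assms(1) unfolding balanced_def by blast
  obtain u1 u2 u3 t1 t2 t3 where g:
    "g y1 z1 x1 = Some u1" "g y2 z2 x2 = Some u2" "g y3 z3 x3 = Some u3"
    "g z1 x1 y1 = Some t1" "g z2 x2 y2 = Some t2" "g z3 x3 y3 = Some t3"
    using assms(2) f unfolding defined_def by (auto simp: mult_fun_def split: option.splits)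
  have "(u1 * v1) * (u2 * v2) * (u3 * v3) + (t1 * w1) * (t2 * w2) * (t3 * w3)
      = (u1 * u2 * u3) * (v1 * v2 * v3 + w1 * w2 * w3)"
    using mult[OF g] by (simp add: algebra_simps)
  then show ?thesis
    using f g sum unfolding balanced_def by (simp add: mult_fun_def)
qed

lemma balanced_recip:
  assumes "balanced f" "defined (\<lambda>a b c. Option.bind (f a b c) partial_recip)"
  shows "balanced (\<lambda>a b c. Option.bind (f a b c) partial_recip)"
proof -
  obtain v1 v2 v3 w1 w2 w3 where f:
    "f y1 z1 x1 = Some v1" "f y2 z2 x2 = Some v2" "f y3 z3 x3 = Some v3"
    "f z1 x1 y1 = Some w1" "f z2 x2 y2 = Some w2" "f z3 x3 y3 = Some w3"
    and sum: "v1 * v2 * v3 + w1 * w2 * w3 = 0"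
    using assms(1) unfolding balanced_def by blast
  have nz: "v1 \<noteq> 0" "v2 \<noteq> 0" "v3 \<noteq> 0" "w1 \<noteq> 0" "w2 \<noteq> 0" "w3 \<noteq> 0"
    using assms(2) f unfolding defined_def by (auto simp: partial_recip_def)
  have "1 / v1 * (1 / v2) * (1 / v3) + 1 / w1 * (1 / w2) * (1 / w3)
      = (v1 * v2 * v3 + w1 * w2 * w3) / ((v1 * v2 * v3) * (w1 * w2 * w3))"
    using nz by (simp add: field_simps)
  then show ?thesis
    using f nz sum unfolding balanced_def by (simp add: partial_recip_def)
qed

lemma conway_sq_prod_eq:
  "(conway y1 z1 x1)\<^sup>2 * (conway y2 z2 x2)\<^sup>2 * (conway y3 z3 x3)\<^sup>2
     = (conway z1 x1 y1)\<^sup>2 * (conway z2 x2 y2)\<^sup>2 * (conway z3 x3 y3)\<^sup>2"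
proof -
  have "(y1 * y2 * y3)\<^sup>2 = (z1 * z2 * z3)\<^sup>2"
    by (simp add: menelaus_lengths)
  then have "y1\<^sup>2 * y2\<^sup>2 * y3\<^sup>2 = z1\<^sup>2 * z2\<^sup>2 * z3\<^sup>2"
    by (simp add: power_mult_distrib)
  then show ?thesis
    using pos cos_sq_at_D cos_sq_at_E cos_sq_at_F by (simp add: conway_sq_eq)
qed

theorem balanced_preserving_operation:
  assumes "preserving_operation f f'" "balanced f" "defined f'"
  shows "balanced f'"
  using assms
proof (induction rule: preserving_operation.induct)
  case isotomic
  then show ?case by (rule balanced_recip)
next
  case isogonal
  let ?r = "\<lambda>a b c. Option.bind (f a b c) partial_recip"
  have "defined ?r"
    using isogonal(2) unfolding defined_def by (auto simp: mult_fun_def split: option.splits)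
  then have "balanced ?r"
    using isogonal(1) by (rule balanced_recip[rotated])
  moreover have "y1\<^sup>2 * y2\<^sup>2 * y3\<^sup>2 = z1\<^sup>2 * z2\<^sup>2 * z3\<^sup>2"
    using menelaus_lengths by (metis power_mult_distrib)
  ultimately show ?case
    using isogonal(2) by (intro balanced_mult_fun) auto
next
  case (side_power k)
  show ?case
  proof (rule balanced_mult_fun[OF side_power])
    have "y1 powi k * y2 powi k * y3 powi k = z1 powi k * z2 powi k * z3 powi k"
      by (simp add: menelaus_lengths flip: power_int_mult_distrib)
    then show "u1 * u2 * u3 = t1 * t2 * t3"
      if "partial_power y1 k = Some u1" "partial_power y2 k = Some u2"
        "partial_power y3 k = Some u3" "partial_power z1 k = Some t1"
        "partial_power z2 k = Some t2" "partial_power z3 k = Some t3"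
      for u1 u2 u3 t1 t2 t3
      using that[THEN partial_power_eq_SomeD] by simp
  qed
next
  case (co_side_power j)
  show ?case
  proof (rule balanced_mult_fun[OF co_side_power])
    have "(z1 * x1) * (z2 * x2) * (z3 * x3) = (x1 * y1) * (x2 * y2) * (x3 * y3)"
      using menelaus_lengths by algebra
    then have "(z1 * x1) powi j * (z2 * x2) powi j * (z3 * x3) powi j
        = (x1 * y1) powi j * (x2 * y2) powi j * (x3 * y3) powi j"
      by (metis power_int_mult_distrib)
    then show "u1 * u2 * u3 = t1 * t2 * t3"
      if "partial_power (z1 * x1) j = Some u1" "partial_power (z2 * x2) j = Some u2"
        "partial_power (z3 * x3) j = Some u3" "partial_power (x1 * y1) j = Some t1"
        "partial_power (x2 * y2) j = Some t2" "partial_power (x3 * y3) j = Some t3"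
      for u1 u2 u3 t1 t2 t3
      using that[THEN partial_power_eq_SomeD] by simp
  qed
next
  case (conway_even m)
  show ?case
    by (rule balanced_mult_fun[OF conway_even])
      (rule partial_power_even_prod_eq[OF _ _ _ _ _ _ conway_sq_prod_eq])
next
  case (co_conway_even n)
  show ?case
  proof (rule balanced_mult_fun[OF co_conway_even], rule partial_power_even_prod_eq)
    \<comment> \<open>The factors \<open>S\<close> at \<open>A\<close>, \<open>B\<close>, \<open>C\<close> occur on both sides; what remains is the previous case.\<close>
    show "(conway z1 x1 y1 * conway x1 y1 z1)\<^sup>2 * (conway z2 x2 y2 * conway x2 y2 z2)\<^sup>2
          * (conway z3 x3 y3 * conway x3 y3 z3)\<^sup>2
        = (conway x1 y1 z1 * conway y1 z1 x1)\<^sup>2 * (conway x2 y2 z2 * conway y2 z2 x2)\<^sup>2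
          * (conway x3 y3 z3 * conway y3 z3 x3)\<^sup>2"
      using conway_sq_prod_eq unfolding power_mult_distrib by algebra
  qed
next
  case (symmetric \<sigma>)
  have rot: "\<sigma> y z x = \<sigma> z x y" if "triangle_sides x y z" for x y z
  proof -
    have "triangle_sides y z x" "triangle_sides z y x"
      using that by (auto simp: triangle_sides_def)
    then show ?thesis
      using symmetric(1) unfolding symmetric_fun_def by metis
  qed
  show ?case
    by (rule balanced_mult_fun[OF symmetric(2,3)]) (use tri[THEN rot] in auto)
next
  case (angular \<Phi>)
  show ?case
    by (rule balanced_mult_fun[OF angular])
      (use cos_sq_at_D cos_sq_at_E cos_sq_at_F in \<open>auto simp: algebra_simps\<close>)
qed

end


section \<open>Ceva's theorem\<close>

lemma noncollinear_iff:
  fixes A B C :: "'a::real_inner"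
  shows "\<not> collinear {A, B, C} \<longleftrightarrow>
    (\<forall>s t. s *\<^sub>R (B - A) + t *\<^sub>R (C - A) = 0 \<longrightarrow> s = 0 \<and> t = 0)"
proof -
  have "collinear {A, B, C} \<longleftrightarrow> collinear {0, B - A, C - A}"
  proof -
    have "collinear {A, B, C} \<longleftrightarrow> collinear {B, A, C}"
      by (simp add: insert_commute)
    also have "\<dots> \<longleftrightarrow> (\<exists>u. \<forall>x\<in>{B, A, C}. \<forall>y\<in>{B, A, C}. \<exists>c. x - y = c *\<^sub>R u)"
      by (simp add: collinear_def)
    also have "\<dots> \<longleftrightarrow> collinear {0, B - A, C - A}"
      unfolding collinear_def by (auto simp: algebra_simps)
    finally show ?thesis .
  qed
  also have "\<dots> \<longleftrightarrow> (\<exists>s t. s *\<^sub>R (B - A) + t *\<^sub>R (C - A) = 0 \<and> (s \<noteq> 0 \<or> t \<noteq> 0))"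
    (is "_ \<longleftrightarrow> ?R")
  proof
    assume "collinear {0, B - A, C - A}"
    then consider "B - A = 0" | "C - A = 0" | c where "C - A = c *\<^sub>R (B - A)"
      unfolding collinear_lemma by blast
    then show ?R
    proof cases
      case 1
      then show ?thesis by (intro exI[of _ 1] exI[of _ 0]) simp
    next
      case 2
      then show ?thesis by (intro exI[of _ 0] exI[of _ 1]) simp
    next
      case 3
      then show ?thesis by (intro exI[of _ "- c"] exI[of _ 1]) simp
    qed
  next
    assume ?R
    then obtain s t where st: "s *\<^sub>R (B - A) + t *\<^sub>R (C - A) = 0" "s \<noteq> 0 \<or> t \<noteq> 0"
      by blast
    show "collinear {0, B - A, C - A}"
    proof (cases "t = 0")
      case True
      then show ?thesis using st by simp
    next
      case False
      have "t *\<^sub>R (C - A) = (- s) *\<^sub>R (B - A)"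
        using st(1) by (simp add: eq_neg_iff_add_eq_0 add.commute)
      then have "C - A = (- s / t) *\<^sub>R (B - A)"
        using False by (metis divideR_right scaleR_scaleR divide_inverse mult.commute)
      then show ?thesis unfolding collinear_lemma by blast
    qed
  qed
  finally show ?thesis by blast
qed

lemma independent_coeffs_eq:
  fixes A B C :: "'a::real_inner"
  assumes "\<not> collinear {A, B, C}"
    "s *\<^sub>R (B - A) + t *\<^sub>R (C - A) = s' *\<^sub>R (B - A) + t' *\<^sub>R (C - A)"
  shows "s = s'" "t = t'"
proof -
  have "(s - s') *\<^sub>R (B - A) + (t - t') *\<^sub>R (C - A) = 0"
    using assms(2) by (simp add: algebra_simps)
  then have "s - s' = 0 \<and> t - t' = 0"
    using assms(1) unfolding noncollinear_iff by blast
  then show "s = s'" "t = t'" by simp_all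
qed

text \<open>The line through the vertex \<open>A\<close> whose points have second and third barycentric
  coordinates in the ratio \<open>u : v\<close>; it degenerates to \<open>{A}\<close> if \<open>u = v = 0\<close>.\<close>

definition vertex_line :: "'a::real_vector \<Rightarrow> 'a \<Rightarrow> 'a \<Rightarrow> real \<Rightarrow> real \<Rightarrow> 'a set" where
  "vertex_line A B C u v = range (\<lambda>t. A + t *\<^sub>R (u *\<^sub>R (B - A) + v *\<^sub>R (C - A)))"

lemma mem_vertex_line_iff:
  fixes A B C :: "'a::real_inner"
  assumes nc: "\<not> collinear {A, B, C}" and nz: "u \<noteq> 0 \<or> v \<noteq> 0" and sum: "p + q + r = 1"
  shows "p *\<^sub>R A + q *\<^sub>R B + r *\<^sub>R C \<in> vertex_line A B C u v \<longleftrightarrow> v * q = u * r"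
proof -
  have p: "p = 1 - q - r" using sum by simp
  have point: "p *\<^sub>R A + q *\<^sub>R B + r *\<^sub>R C = A + (q *\<^sub>R (B - A) + r *\<^sub>R (C - A))"
    unfolding p by (simp add: algebra_simps)
  have "p *\<^sub>R A + q *\<^sub>R B + r *\<^sub>R C \<in> vertex_line A B C u v \<longleftrightarrow>
      (\<exists>t. q *\<^sub>R (B - A) + r *\<^sub>R (C - A) = (t * u) *\<^sub>R (B - A) + (t * v) *\<^sub>R (C - A))"
    unfolding point vertex_line_def by (auto simp: scaleR_add_right)
  also have "\<dots> \<longleftrightarrow> (\<exists>t. q = t * u \<and> r = t * v)"
    using independent_coeffs_eq[OF nc] by metis
  also have "\<dots> \<longleftrightarrow> v * q = u * r"
  proof
    assume eq: "v * q = u * r"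
    show "\<exists>t. q = t * u \<and> r = t * v"
    proof (cases "u = 0")
      case True
      then show ?thesis using nz eq by (intro exI[of _ "r / v"]) auto
    next
      case False
      then show ?thesis using eq by (intro exI[of _ "q / u"]) (simp add: field_simps)
    qed
  qed auto
  finally show ?thesis .
qed

lemma affine_parallel_lines_iff:
  fixes P Q u v :: "'a::real_vector"
  assumes "v \<noteq> 0"
  shows "affine_parallel (range (\<lambda>t::real. P + t *\<^sub>R u)) (range (\<lambda>t::real. Q + t *\<^sub>R v))
    \<longleftrightarrow> (\<exists>k. v = k *\<^sub>R u)"
proof
  assume "affine_parallel (range (\<lambda>t::real. P + t *\<^sub>R u)) (range (\<lambda>t::real. Q + t *\<^sub>R v))"
  then obtain a where a: "range (\<lambda>t::real. Q + t *\<^sub>R v) = (+) a ` range (\<lambda>t::real. P + t *\<^sub>R u)"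
    unfolding affine_parallel_def by blast
  have "Q + 0 *\<^sub>R v \<in> range (\<lambda>t::real. Q + t *\<^sub>R v)" "Q + 1 *\<^sub>R v \<in> range (\<lambda>t::real. Q + t *\<^sub>R v)"
    by blast+
  then obtain s t where st: "Q + 0 *\<^sub>R v = a + (P + s *\<^sub>R u)" "Q + 1 *\<^sub>R v = a + (P + t *\<^sub>R u)"
    unfolding a by blast
  have "v = (Q + 1 *\<^sub>R v) - (Q + 0 *\<^sub>R v)" by simp
  also have "\<dots> = (t - s) *\<^sub>R u" unfolding st by (simp add: algebra_simps)
  finally show "\<exists>k. v = k *\<^sub>R u" ..
next
  assume "\<exists>k. v = k *\<^sub>R u"
  then obtain k where k: "v = k *\<^sub>R u" ..
  then have "k \<noteq> 0" using assms by auto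
  have "(\<lambda>t. Q + t *\<^sub>R v) = (\<lambda>t. (Q - P) + (P + t *\<^sub>R u)) \<circ> (\<lambda>t. t * k)"
    by (auto simp: k)
  moreover have "range (\<lambda>t. t * k) = UNIV"
    using \<open>k \<noteq> 0\<close> by (intro surjI[of _ "\<lambda>t. t / k"]) simp
  ultimately have "range (\<lambda>t. Q + t *\<^sub>R v) = range (\<lambda>t. (Q - P) + (P + t *\<^sub>R u))"
    by (metis image_comp)
  then show "affine_parallel (range (\<lambda>t::real. P + t *\<^sub>R u)) (range (\<lambda>t::real. Q + t *\<^sub>R v))"
    unfolding affine_parallel_def image_image by blast
qed

lemma affine_parallel_vertex_lines_iff:
  fixes A B C :: "'a::real_inner"
  assumes nc: "\<not> collinear {A, B, C}" and a: "a1 \<noteq> 0 \<or> a2 \<noteq> 0" and b: "b1 \<noteq> 0 \<or> b2 \<noteq> 0"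
  shows "affine_parallel (vertex_line A B C a1 a2) (vertex_line B C A b1 b2)
    \<longleftrightarrow> a2 * b2 + a1 * b1 + a2 * b1 = 0"
proof -
  have dir: "b1 *\<^sub>R (C - B) + b2 *\<^sub>R (A - B) = (- b1 - b2) *\<^sub>R (B - A) + b1 *\<^sub>R (C - A)"
    by (simp add: algebra_simps)
  have "b1 *\<^sub>R (C - B) + b2 *\<^sub>R (A - B) \<noteq> 0"
    unfolding dir using nc b unfolding noncollinear_iff by force
  then have "affine_parallel (vertex_line A B C a1 a2) (vertex_line B C A b1 b2) \<longleftrightarrow>
      (\<exists>k. (- b1 - b2) *\<^sub>R (B - A) + b1 *\<^sub>R (C - A)
          = (k * a1) *\<^sub>R (B - A) + (k * a2) *\<^sub>R (C - A))"
    unfolding vertex_line_def dir[symmetric]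
    by (subst affine_parallel_lines_iff) (auto simp: scaleR_add_right)
  also have "\<dots> \<longleftrightarrow> (\<exists>k. - b1 - b2 = k * a1 \<and> b1 = k * a2)"
    using independent_coeffs_eq[OF nc] by metis
  also have "\<dots> \<longleftrightarrow> a2 * b2 + a1 * b1 + a2 * b1 = 0"
  proof
    assume "\<exists>k. - b1 - b2 = k * a1 \<and> b1 = k * a2"
    then show "a2 * b2 + a1 * b1 + a2 * b1 = 0" by algebra
  next
    assume eq: "a2 * b2 + a1 * b1 + a2 * b1 = 0"
    show "\<exists>k. - b1 - b2 = k * a1 \<and> b1 = k * a2"
    proof (cases "a1 = 0")
      case True
      then show ?thesis
        using a eq by (intro exI[of _ "b1 / a2"]) (simp add: algebra_simps, algebra)
    next
      case False
      then show ?thesis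
        using eq by (intro exI[of _ "(- b1 - b2) / a1"]) (simp add: field_simps)
    qed
  qed
  finally show ?thesis .
qed

lemma concurrent_lines_rotate: "concurrent_lines L M N \<Longrightarrow> concurrent_lines M N L"
  unfolding concurrent_lines_def by (auto simp: Int_ac affine_parallel_commute)


text \<open>The lines through \<open>A\<close> and \<open>B\<close>, if not parallel, meet in the point with homogeneous barycentric coordinates
  \<open>(a\<^sub>2 b\<^sub>2 : a\<^sub>1 b\<^sub>1 : a\<^sub>2 b\<^sub>1)\<close>.\<close>

lemma concurrent_lines_if_not_parallel:
  fixes A B C :: "real^2"
  assumes nc: "\<not> collinear {A, B, C}"
    and nz: "a1 \<noteq> 0 \<or> a2 \<noteq> 0" "b1 \<noteq> 0 \<or> b2 \<noteq> 0" "c1 \<noteq> 0 \<or> c2 \<noteq> 0"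
    and prod: "a1 * b1 * c1 = a2 * b2 * c2"
    and s: "a2 * b2 + a1 * b1 + a2 * b1 \<noteq> 0"
  shows "concurrent_lines (vertex_line A B C a1 a2) (vertex_line B C A b1 b2)
    (vertex_line C A B c1 c2)"
proof -
  define \<sigma> where "\<sigma> = a2 * b2 + a1 * b1 + a2 * b1"
  define p q r where "p = a2 * b2 / \<sigma>" and "q = a1 * b1 / \<sigma>" and "r = a2 * b1 / \<sigma>"
  have sum: "p + q + r = 1"
    using s unfolding p_def q_def r_def \<sigma>_def by (simp flip: add_divide_distrib)
  have nc': "\<not> collinear {B, C, A}" "\<not> collinear {C, A, B}"
    using nc by (simp_all add: insert_commute)
  have "p *\<^sub>R A + q *\<^sub>R B + r *\<^sub>R C \<in> vertex_line A B C a1 a2"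
    using mem_vertex_line_iff[OF nc nz(1) sum] by (simp add: q_def r_def)
  moreover have "q *\<^sub>R B + r *\<^sub>R C + p *\<^sub>R A \<in> vertex_line B C A b1 b2"
    using mem_vertex_line_iff[OF nc'(1) nz(2), of q r p] sum by (simp add: p_def r_def)
  moreover have "r *\<^sub>R C + p *\<^sub>R A + q *\<^sub>R B \<in> vertex_line C A B c1 c2"
    using mem_vertex_line_iff[OF nc'(2) nz(3), of r p q] sum prod
    by (simp add: p_def q_def ac_simps)
  ultimately show ?thesis
    unfolding concurrent_lines_def by (auto simp: ac_simps)
qed

theorem ceva:
  fixes A B C :: "real^2"
  assumes nc: "\<not> collinear {A, B, C}"
    and nz: "a1 \<noteq> 0 \<or> a2 \<noteq> 0" "b1 \<noteq> 0 \<or> b2 \<noteq> 0" "c1 \<noteq> 0 \<or> c2 \<noteq> 0"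
  shows "concurrent_lines (vertex_line A B C a1 a2) (vertex_line B C A b1 b2)
      (vertex_line C A B c1 c2) \<longleftrightarrow> a1 * b1 * c1 = a2 * b2 * c2"
    (is "concurrent_lines ?L ?M ?N \<longleftrightarrow> ?prod")
proof
  have nc': "\<not> collinear {B, C, A}" "\<not> collinear {C, A, B}"
    using nc by (simp_all add: insert_commute)
  have prodI: ?prod
    if "a2 * q = a1 * r" "b2 * r = b1 * p" "c2 * p = c1 * q" "p \<noteq> 0 \<or> q \<noteq> 0 \<or> r \<noteq> 0" for p q r
  proof -
    have "(a1 * b1 * c1 - a2 * b2 * c2) * p = 0" "(a1 * b1 * c1 - a2 * b2 * c2) * q = 0"
      "(a1 * b1 * c1 - a2 * b2 * c2) * r = 0"
      using that(1-3) by algebra+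
    then show ?thesis using that(4) by auto
  qed
  {
    assume "concurrent_lines ?L ?M ?N"
    then consider X where "X \<in> ?L" "X \<in> ?M" "X \<in> ?N"
      | "affine_parallel ?L ?M" "affine_parallel ?N ?L"
      unfolding concurrent_lines_def
      by (metis IntD1 IntD2 all_not_in_conv affine_parallel_commute)
    then show ?prod
    proof cases
      case 1
      obtain t where "X = A + t *\<^sub>R (a1 *\<^sub>R (B - A) + a2 *\<^sub>R (C - A))"
        using 1(1) unfolding vertex_line_def by blast
      define p q r where "p = 1 - t * a1 - t * a2" and "q = t * a1" and "r = t * a2"
      have sum: "p + q + r = 1"
        by (simp add: p_def q_def r_def)
      have X: "X = p *\<^sub>R A + q *\<^sub>R B + r *\<^sub>R C"
        unfolding \<open>X = _\<close> p_def q_def r_def by (simp add: algebra_simps)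
      have "b2 * r = b1 * p"
        using mem_vertex_line_iff[OF nc'(1) nz(2), of q r p] sum 1(2) by (simp add: X ac_simps)
      moreover have "c2 * p = c1 * q"
        using mem_vertex_line_iff[OF nc'(2) nz(3), of r p q] sum 1(3) by (simp add: X ac_simps)
      moreover have "a2 * q = a1 * r"
        by (simp add: q_def r_def)
      ultimately show ?thesis
        using sum by (intro prodI) auto
    next
      case 2
      \<comment> \<open>Here the lines share the point at infinity with coordinates
        \<open>(- a\<^sub>1 - a\<^sub>2 : a\<^sub>1 : a\<^sub>2)\<close>.\<close>
      have "a2 * b2 + a1 * b1 + a2 * b1 = 0"
        using 2(1) affine_parallel_vertex_lines_iff[OF nc nz(1,2)] by simp
      moreover have "c2 * a2 + c1 * a1 + c2 * a1 = 0"
        using 2(2) affine_parallel_vertex_lines_iff[OF nc'(2) nz(3,1)] by simp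
      ultimately show ?thesis
        using nz(1) by (intro prodI[of a1 a2 "- a1 - a2"]) (auto simp: algebra_simps)
    qed
  }
  assume prod: ?prod
  consider "a2 * b2 + a1 * b1 + a2 * b1 \<noteq> 0" | "b2 * c2 + b1 * c1 + b2 * c1 \<noteq> 0"
    | "c2 * a2 + c1 * a1 + c2 * a1 \<noteq> 0"
    | "a2 * b2 + a1 * b1 + a2 * b1 = 0" "b2 * c2 + b1 * c1 + b2 * c1 = 0"
      "c2 * a2 + c1 * a1 + c2 * a1 = 0"
    by blast
  then show "concurrent_lines ?L ?M ?N"
  proof cases
    case 1
    then show ?thesis using concurrent_lines_if_not_parallel[OF nc nz prod] by simp
  next
    case 2
    have "b1 * c1 * a1 = b2 * c2 * a2" using prod by (simp add: ac_simps)
    then show ?thesis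
      using concurrent_lines_if_not_parallel[OF nc'(1) nz(2,3,1) _ 2] concurrent_lines_rotate
      by blast
  next
    case 3
    have "c1 * a1 * b1 = c2 * a2 * b2" using prod by (simp add: ac_simps)
    then show ?thesis
      using concurrent_lines_if_not_parallel[OF nc'(2) nz(3,1,2) _ 3] concurrent_lines_rotate
      by blast
  next
    case 4
    then show ?thesis
      using affine_parallel_vertex_lines_iff[OF nc nz(1,2)]
        affine_parallel_vertex_lines_iff[OF nc'(1) nz(2,3)]
        affine_parallel_vertex_lines_iff[OF nc'(2) nz(3,1)]
      unfolding concurrent_lines_def by (metis affine_parallel_commute)
  qed
qed


section \<open>Lines from a vertex to a triangle center\<close>

text \<open>Whether the center is proper or at infinity, its first coordinate does not affect the line.\<close>

lemma join_line_barycentric_point: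
  assumes "barycentric_point u v w P Q R = Some G" "G \<noteq> Proper P"
  shows "join_line P G = vertex_line P Q R v w" "v \<noteq> 0 \<or> w \<noteq> 0"
proof -
  show vw: "v \<noteq> 0 \<or> w \<noteq> 0"
    using assms by (auto simp: barycentric_point_def split: if_splits)
  show "join_line P G = vertex_line P Q R v w"
  proof (cases "u + v + w = 0")
    case True
    then have u: "u = - v - w" by simp
    have "G = At_Infinity (u *\<^sub>R P + v *\<^sub>R Q + w *\<^sub>R R)"
      using assms(1) True vw by (auto simp: barycentric_point_def split: if_splits)
    also have "u *\<^sub>R P + v *\<^sub>R Q + w *\<^sub>R R = v *\<^sub>R (Q - P) + w *\<^sub>R (R - P)"
      unfolding u by (simp add: algebra_simps)
    finally show ?thesis by (simp add: vertex_line_def)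
  next
    case False
    define s where "s = u + v + w"
    have s: "s \<noteq> 0" "u = s - v - w" using False by (simp_all add: s_def)
    have "G = Proper ((1 / s) *\<^sub>R (u *\<^sub>R P + v *\<^sub>R Q + w *\<^sub>R R))"
      using assms(1) False vw by (auto simp: barycentric_point_def s_def split: if_splits)
    also have "(1 / s) *\<^sub>R (u *\<^sub>R P + v *\<^sub>R Q + w *\<^sub>R R)
        = (1 / s) *\<^sub>R (s *\<^sub>R P) + (1 / s) *\<^sub>R (v *\<^sub>R (Q - P) + w *\<^sub>R (R - P))"
      unfolding s(2) scaleR_add_right[symmetric] by (simp add: algebra_simps)
    also have "\<dots> = P + (1 / s) *\<^sub>R (v *\<^sub>R (Q - P) + w *\<^sub>R (R - P))"
      using s(1) by simp
    finally have "join_line P G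
        = range (\<lambda>t. P + t *\<^sub>R ((1 / s) *\<^sub>R (v *\<^sub>R (Q - P) + w *\<^sub>R (R - P))))"
      by (simp add: affine_hull_2_alt)
    also have "\<dots> = (\<lambda>t. P + t *\<^sub>R (v *\<^sub>R (Q - P) + w *\<^sub>R (R - P))) ` range (\<lambda>t. t / s)"
      by (simp add: image_image)
    also have "range (\<lambda>t. t / s) = UNIV"
      using s(1) by (intro surjI[of _ "\<lambda>t. t * s"]) simp
    finally show ?thesis by (simp add: vertex_line_def)
  qed
qed

lemma join_line_center_point:
  assumes "center_point f P Q R = Some G" "G \<noteq> Proper P"
  obtains v w where "f (dist R P) (dist P Q) (dist Q R) = Some v"
    "f (dist P Q) (dist Q R) (dist R P) = Some w" "v \<noteq> 0 \<or> w \<noteq> 0"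
    "join_line P G = vertex_line P Q R v w"
proof -
  obtain u v w where fv: "f (dist R P) (dist P Q) (dist Q R) = Some v"
    and fw: "f (dist P Q) (dist Q R) (dist R P) = Some w"
    and G: "barycentric_point u v w P Q R = Some G"
    using assms(1) by (auto simp: center_point_def Let_def split: option.splits)
  show thesis
    using that[OF fv fw] join_line_barycentric_point[OF G assms(2)] by blast
qed


section \<open>The corner triangles\<close>

lemma triangle_sides_dist:
  fixes P Q R :: "'a::euclidean_space"
  assumes "\<not> collinear {P, Q, R}"
  shows "triangle_sides (dist Q R) (dist R P) (dist P Q)"
proof -
  have strict: "dist X Y < dist Y Z + dist Z X"
    if "{X, Z, Y} = {P, Q, R}" for X Y Z
  proof -
    have "\<not> between (X, Y) Z"
      using between_imp_collinear[of X Y Z] assms that by auto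
    then have "dist X Y \<noteq> dist X Z + dist Z Y"
      by (simp add: between)
    then show ?thesis
      using dist_triangle[of X Y Z] by (simp add: dist_commute)
  qed
  show ?thesis
    unfolding triangle_sides_def
    using strict[of Q P R] strict[of R Q P] strict[of P R Q]
    by (auto simp: insert_commute dist_commute)
qed

lemma conway_dist:
  fixes P Q R :: "'a::real_inner"
  shows "conway (dist Q R) (dist R P) (dist P Q) = 2 * inner (Q - P) (R - P)"
  by (simp add: conway_def dist_norm power2_norm_eq_inner algebra_simps inner_commute)

lemma cos_sq_angle_dist:
  fixes P Q R :: "'a::real_inner"
  shows "cos_sq_angle (dist Q R) (dist R P) (dist P Q)
    = (inner (Q - P) (R - P))\<^sup>2 / (inner (Q - P) (Q - P) * inner (R - P) (R - P))"
proof -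
  have "(dist P Q)\<^sup>2 = inner (Q - P) (Q - P)" "(dist R P)\<^sup>2 = inner (R - P) (R - P)"
    by (simp_all add: dist_norm norm_minus_commute[of P Q] power2_norm_eq_inner)
  then show ?thesis
    unfolding cos_sq_angle_def conway_dist by (simp add: power_mult_distrib ac_simps)
qed

lemma cos_sq_angle_dist_scale:
  fixes P Q R :: "'a::real_inner"
  assumes "Q' - P = k *\<^sub>R (Q - P)" "R' - P = m *\<^sub>R (R - P)" "k \<noteq> 0" "m \<noteq> 0"
  shows "cos_sq_angle (dist Q' R') (dist R' P) (dist P Q')
    = cos_sq_angle (dist Q R) (dist R P) (dist P Q)"
  using assms(3,4) unfolding cos_sq_angle_dist assms(1,2)
  by (simp add: power2_eq_square)

lemma collinear_scale:
  fixes P Q R :: "'a::real_inner"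
  assumes "collinear {P, Q, R}" "P \<noteq> Q" "P \<noteq> R"
  obtains k where "k \<noteq> 0" "R - P = k *\<^sub>R (Q - P)"
proof -
  obtain s t where st: "s *\<^sub>R (Q - P) + t *\<^sub>R (R - P) = 0" "s \<noteq> 0 \<or> t \<noteq> 0"
    using assms(1) noncollinear_iff[of P Q R] by blast
  have nz: "s \<noteq> 0" "t \<noteq> 0"
    using st assms(2,3) by auto
  have "t *\<^sub>R (R - P) = (- s) *\<^sub>R (Q - P)"
    using st(1) by (simp add: eq_neg_iff_add_eq_0 add.commute)
  then have "R - P = (- s / t) *\<^sub>R (Q - P)"
    using nz by (metis divideR_right scaleR_scaleR divide_inverse mult.commute)
  then show thesis using that[of "- s / t"] nz by simp
qed

text \<open>A triangle \<open>ABC\<close> with collinear points \<open>D\<close>, \<open>E\<close>, \<open>F\<close> on its sidelines \<open>BC\<close>, \<open>CA\<close>, \<open>AB\<close>,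
  none of them a vertex. Facts about the corner triangle at \<open>A\<close> are proved once and transferred
  to \<open>B\<close> and \<open>C\<close> by the cyclic symmetry of these assumptions.\<close>

locale transversal_points =
  fixes A B C D E F :: "real^2" and \<delta> \<epsilon> \<phi> :: real
  assumes nc: "\<not> collinear {A, B, C}"
    and D: "D = B + \<delta> *\<^sub>R (C - B)" "\<delta> \<noteq> 0" "\<delta> \<noteq> 1"
    and E: "E = C + \<epsilon> *\<^sub>R (A - C)" "\<epsilon> \<noteq> 0" "\<epsilon> \<noteq> 1"
    and F: "F = A + \<phi> *\<^sub>R (B - A)" "\<phi> \<noteq> 0" "\<phi> \<noteq> 1"
    and DEF: "collinear {D, E, F}"
begin

lemma cyclic: "transversal_points B C A E F D \<epsilon> \<phi> \<delta>"
  using nc D E F DEF by unfold_locales (auto simp: insert_commute)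

lemma E_minus_A: "E - A = (1 - \<epsilon>) *\<^sub>R (C - A)"
  and F_minus_A: "F - A = \<phi> *\<^sub>R (B - A)"
  by (simp_all add: E F algebra_simps)

lemma E_neq_F: "E \<noteq> F"
proof
  assume "E = F"
  then have "(1 - \<epsilon>) *\<^sub>R (C - A) = \<phi> *\<^sub>R (B - A)"
    by (metis E_minus_A F_minus_A)
  then have "(- \<phi>) *\<^sub>R (B - A) + (1 - \<epsilon>) *\<^sub>R (C - A) = 0"
    by simp
  then have "- \<phi> = 0"
    using nc unfolding noncollinear_iff by blast
  then show False using F(2) by simp
qed

lemma corner_noncollinear: "\<not> collinear {A, E, F}"
proof -
  have "s = 0 \<and> t = 0" if "s *\<^sub>R (E - A) + t *\<^sub>R (F - A) = 0" for s t
  proof -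
    have "(t * \<phi>) *\<^sub>R (B - A) + (s * (1 - \<epsilon>)) *\<^sub>R (C - A) = 0"
      using that by (simp add: E_minus_A F_minus_A add.commute)
    then have "t * \<phi> = 0 \<and> s * (1 - \<epsilon>) = 0"
      using nc unfolding noncollinear_iff by blast
    then show ?thesis using E F by simp
  qed
  then show ?thesis unfolding noncollinear_iff by blast
qed

lemma corner_vertex_line:
  "vertex_line A E F v w = vertex_line A B C (w * \<phi>) (v * (1 - \<epsilon>))"
  unfolding vertex_line_def E_minus_A F_minus_A by (simp add: add.commute)

theorem menelaus: "\<delta> * \<epsilon> * \<phi> = - ((1 - \<delta>) * (1 - \<epsilon>) * (1 - \<phi>))"
proof -
  have "\<not> (\<forall>s t. s *\<^sub>R (E - D) + t *\<^sub>R (F - D) = 0 \<longrightarrow> s = 0 \<and> t = 0)"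
    using DEF noncollinear_iff[of D E F] by simp
  then obtain s t where st: "s *\<^sub>R (E - D) + t *\<^sub>R (F - D) = 0" "s \<noteq> 0 \<or> t \<noteq> 0"
    by blast
  have "s *\<^sub>R (E - D) + t *\<^sub>R (F - D)
      = (t * (\<phi> - 1 + \<delta>) - s * (1 - \<delta>)) *\<^sub>R (B - A) + (s * (1 - \<epsilon> - \<delta>) - t * \<delta>) *\<^sub>R (C - A)"
    by (simp add: D(1) E(1) F(1) algebra_simps)
  then have "t * (\<phi> - 1 + \<delta>) - s * (1 - \<delta>) = 0" "s * (1 - \<epsilon> - \<delta>) - t * \<delta> = 0"
    using st(1) nc unfolding noncollinear_iff by metis+
  then have "s * (\<delta> * \<epsilon> * \<phi> + (1 - \<delta>) * (1 - \<epsilon>) * (1 - \<phi>)) = 0"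
    "t * (\<delta> * \<epsilon> * \<phi> + (1 - \<delta>) * (1 - \<epsilon>) * (1 - \<phi>)) = 0"
    by algebra+
  then show ?thesis using st(2) by (auto simp: eq_neg_iff_add_eq_0)
qed

lemma cos_sq_angle_at_E:
  "cos_sq_angle (dist F A) (dist A E) (dist E F) = cos_sq_angle (dist C D) (dist D E) (dist E C)"
proof -
  interpret BCA: transversal_points B C A E F D \<epsilon> \<phi> \<delta> by (rule cyclic)
  interpret CAB: transversal_points C A B F D E \<phi> \<delta> \<epsilon> by (rule BCA.cyclic)
  have EDF: "collinear {E, D, F}" using DEF by (simp add: insert_commute)
  obtain m where m: "m \<noteq> 0" "F - E = m *\<^sub>R (D - E)"
    using collinear_scale[OF EDF] E_neq_F CAB.E_neq_F by metis
  have "A - E = ((\<epsilon> - 1) / \<epsilon>) *\<^sub>R (C - E)"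
  proof -
    have "C - E = (- \<epsilon>) *\<^sub>R (A - C)" "A - E = (1 - \<epsilon>) *\<^sub>R (A - C)"
      by (simp_all add: E(1) algebra_simps)
    then show ?thesis using E(2) by (simp add: scaleR_left_diff_distrib)
  qed
  then show ?thesis
    using cos_sq_angle_dist_scale[of A E "(\<epsilon> - 1) / \<epsilon>" C F m D] m E
    by (simp add: cos_sq_angle_commute dist_commute)
qed

lemma dist_ratio: "dist F A = \<bar>\<phi>\<bar> * dist A B" "dist B F = \<bar>1 - \<phi>\<bar> * dist A B"
proof -
  have "F - A = \<phi> *\<^sub>R (B - A)" "B - F = (1 - \<phi>) *\<^sub>R (B - A)"
    by (simp_all add: F(1) algebra_simps)
  then show "dist F A = \<bar>\<phi>\<bar> * dist A B" "dist B F = \<bar>1 - \<phi>\<bar> * dist A B"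
    by (simp_all add: dist_norm norm_minus_commute)
qed

sublocale corner_sides
  "dist E F" "dist F A" "dist A E" "dist F D" "dist D B" "dist B F" "dist D E" "dist E C" "dist C D"
proof -
  interpret BCA: transversal_points B C A E F D \<epsilon> \<phi> \<delta> by (rule cyclic)
  interpret CAB: transversal_points C A B F D E \<phi> \<delta> \<epsilon> by (rule BCA.cyclic)
  show "corner_sides (dist E F) (dist F A) (dist A E) (dist F D) (dist D B) (dist B F)
      (dist D E) (dist E C) (dist C D)"
  proof
    have "\<bar>\<delta> * \<epsilon> * \<phi>\<bar> = \<bar>(1 - \<delta>) * (1 - \<epsilon>) * (1 - \<phi>)\<bar>"
      using menelaus by simp
    then show "dist F A * dist D B * dist E C = dist A E * dist B F * dist C D"
      unfolding dist_ratio BCA.dist_ratio CAB.dist_ratio abs_mult by algebra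
  qed (rule triangle_sides_dist[OF corner_noncollinear]
      triangle_sides_dist[OF BCA.corner_noncollinear]
      triangle_sides_dist[OF CAB.corner_noncollinear]
      cos_sq_angle_at_E BCA.cos_sq_angle_at_E CAB.cos_sq_angle_at_E)+
qed

text \<open>Ceva's condition for the three lines reads
  \<open>W \<delta> \<epsilon> \<phi> = V (1 - \<delta>) (1 - \<epsilon>) (1 - \<phi>)\<close>, which Menelaus' theorem turns into \<open>W = - V\<close>.\<close>

theorem concurrent_iff_balanced:
  assumes "center_point f A E F = Some G" "G \<noteq> Proper A"
    and "center_point f B F D = Some H" "H \<noteq> Proper B"
    and "center_point f C D E = Some I" "I \<noteq> Proper C"
  shows "defined f"
    and "concurrent_lines (join_line A G) (join_line B H) (join_line C I) \<longleftrightarrow> balanced f"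
proof -
  interpret BCA: transversal_points B C A E F D \<epsilon> \<phi> \<delta> by (rule cyclic)
  interpret CAB: transversal_points C A B F D E \<phi> \<delta> \<epsilon> by (rule BCA.cyclic)
  obtain v1 w1 where 1: "f (dist F A) (dist A E) (dist E F) = Some v1"
    "f (dist A E) (dist E F) (dist F A) = Some w1" "v1 \<noteq> 0 \<or> w1 \<noteq> 0"
    "join_line A G = vertex_line A E F v1 w1"
    using join_line_center_point[OF assms(1,2)] .
  obtain v2 w2 where 2: "f (dist D B) (dist B F) (dist F D) = Some v2"
    "f (dist B F) (dist F D) (dist D B) = Some w2" "v2 \<noteq> 0 \<or> w2 \<noteq> 0"
    "join_line B H = vertex_line B F D v2 w2"
    using join_line_center_point[OF assms(3,4)] .
  obtain v3 w3 where 3: "f (dist E C) (dist C D) (dist D E) = Some v3"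
    "f (dist C D) (dist D E) (dist E C) = Some w3" "v3 \<noteq> 0 \<or> w3 \<noteq> 0"
    "join_line C I = vertex_line C D E v3 w3"
    using join_line_center_point[OF assms(5,6)] .
  show "defined f"
    unfolding defined_def using 1 2 3 by simp
  have "concurrent_lines (join_line A G) (join_line B H) (join_line C I) \<longleftrightarrow>
      (w1 * \<phi>) * (w2 * \<delta>) * (w3 * \<epsilon>) = (v1 * (1 - \<epsilon>)) * (v2 * (1 - \<phi>)) * (v3 * (1 - \<delta>))"
    unfolding 1(4) 2(4) 3(4) corner_vertex_line BCA.corner_vertex_line CAB.corner_vertex_line
    by (rule ceva[OF nc]) (use 1(3) 2(3) 3(3) D E F in auto)
  also have "\<dots> \<longleftrightarrow> (v1 * v2 * v3 + w1 * w2 * w3) * (\<delta> * \<epsilon> * \<phi>) = 0"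
    using menelaus by algebra
  also have "\<dots> \<longleftrightarrow> v1 * v2 * v3 + w1 * w2 * w3 = 0"
    using D E F by simp
  also have "\<dots> \<longleftrightarrow> balanced f"
    unfolding balanced_def using 1 2 3 by simp
  finally show "concurrent_lines (join_line A G) (join_line B H) (join_line C I) \<longleftrightarrow> balanced f" .
qed

end

lemma transversal_pointsI:
  assumes "\<not> collinear {A, B, C}" "admissible_transversal A B C l"
    and "l \<inter> affine hull {B, C} = {D}" "l \<inter> affine hull {C, A} = {E}"
    and "l \<inter> affine hull {A, B} = {F}"
  obtains \<delta> \<epsilon> \<phi> where "transversal_points A B C D E F \<delta> \<epsilon> \<phi>"
proof -
  have l: "A \<notin> l" "B \<notin> l" "C \<notin> l" "aff_dim l = 1"
    using assms(2) by (auto simp: admissible_transversal_def)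
  have "\<exists>t. Z = X + t *\<^sub>R (Y - X) \<and> t \<noteq> 0 \<and> t \<noteq> 1"
    if "l \<inter> affine hull {X, Y} = {Z}" "X \<notin> l" "Y \<notin> l" for X Y Z
  proof -
    have "Z \<in> l" "Z \<in> affine hull {X, Y}" using that(1) by auto
    then obtain t where t: "Z = X + t *\<^sub>R (Y - X)" unfolding affine_hull_2_alt by blast
    then have "t \<noteq> 0" "t \<noteq> 1" using that(2,3) \<open>Z \<in> l\<close> by auto
    then show ?thesis using t by blast
  qed
  then obtain \<delta> \<epsilon> \<phi> where par:
    "D = B + \<delta> *\<^sub>R (C - B)" "\<delta> \<noteq> 0" "\<delta> \<noteq> 1"
    "E = C + \<epsilon> *\<^sub>R (A - C)" "\<epsilon> \<noteq> 0" "\<epsilon> \<noteq> 1"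
    "F = A + \<phi> *\<^sub>R (B - A)" "\<phi> \<noteq> 0" "\<phi> \<noteq> 1"
    using assms(3-5) l(1-3) by metis
  have "collinear l" using l(4) by (simp add: collinear_aff_dim)
  moreover have "{D, E, F} \<subseteq> l" using assms(3-5) by auto
  ultimately have "collinear {D, E, F}" by (rule collinear_subset)
  then show thesis
    using that par assms(1) unfolding transversal_points_def by blast
qed

theorem theorem6p4:
  fixes A B C :: "real^2" and l :: "(real^2) set" and f f' :: side_fun
  assumes "\<not> collinear {A, B, C}"
    and "admissible_transversal A B C l"
    and "center_function f"
    and "concurrent_for f A B C l"
    and "preserving_operation f f'"
    and "\<exists>L M N. corner_lines f' A B C l L M N"
  shows "concurrent_for f' A B C l"
proof -
  obtain D E F G H I where pts: "l \<inter> affine hull {B, C} = {D}" "l \<inter> affine hull {C, A} = {E}"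
      "l \<inter> affine hull {A, B} = {F}"
    and f: "center_point f A E F = Some G" "G \<noteq> Proper A"
      "center_point f B F D = Some H" "H \<noteq> Proper B"
      "center_point f C D E = Some I" "I \<noteq> Proper C"
    and conc: "concurrent_lines (join_line A G) (join_line B H) (join_line C I)"
    using assms(4) unfolding concurrent_for_def corner_lines_def by blast
  obtain G' H' I' where f': "center_point f' A E F = Some G'" "G' \<noteq> Proper A"
      "center_point f' B F D = Some H'" "H' \<noteq> Proper B"
      "center_point f' C D E = Some I'" "I' \<noteq> Proper C"
    using assms(6) unfolding corner_lines_def pts by auto
  obtain \<delta> \<epsilon> \<phi> where "transversal_points A B C D E F \<delta> \<epsilon> \<phi>"
    using transversal_pointsI[OF assms(1,2) pts] .
  then interpret transversal_points A B C D E F \<delta> \<epsilon> \<phi> .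
  have "balanced f"
    using concurrent_iff_balanced(2)[OF f] conc by simp
  then have "balanced f'"
    using balanced_preserving_operation[OF assms(5)] concurrent_iff_balanced(1)[OF f'] by simp
  then have "concurrent_lines (join_line A G') (join_line B H') (join_line C I')"
    using concurrent_iff_balanced(2)[OF f'] by simp
  then show ?thesis
    unfolding concurrent_for_def corner_lines_def using pts f' by blast
qed

end
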